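(* Let $(X,\mathcal A)$ be an analytic measurable space, $\Sigma$ a countable set of actions, $c\in[0,1]$, $\gamma$ a Markov decision process on $X$, and $\mathcal L$ a language as in the context. Assume that each index set $Y_i$ carries a second countable Hausdorff topology $\tau_i$ and that for each $i$ the map $[0,1]^{n_i}\times Y_i\to[0,1]$, $(\vec u,y)\mapsto f_{iy}(\vec u)$, is continuous for the product topology. Then the theory map $\mathrm{th}$ is topologisable by a second countable Hausdorff topology on $\mathcal L$.
   Context: A subset of $(X,\mathcal A)$ is Suslin if it is the projection to $X$ of a set in $\mathcal B(\mathbb N^{\mathbb N})\otimes\mathcal A$; $(X,\mathcal A)$ is analytic if isomorphic to a Suslin subset of a standard Borel space with the restricted $\sigma$-algebra. A Markov decision process assigns to each $a\in\Sigma,x\in X$ a probability measure $\gamma^0_{a,x}$ and reward $\gamma^1_{a,x}\in[0,1]$, measurable in $x$ (for $x\mapsto\gamma^0_{a,x}(U)$, $U\in\mathcal A$). Language: for each $i\in\omega$ a set $Y_i$, an arity $n_i\ge0$, and for $y\in Y_i$ a function symbol $f_{iy}$ interpreted by $f_{iy}\colon[0,1]^{n_i}\to[0,1]$. Formulas: $\top\mid\neg\varphi\mid\varphi\wedge\psi\mid\diamond_a\varphi\ (a\in\Sigma)\mid f_{iy}(\varphi_1,\ldots,\varphi_{n_i})$; interpretation $[\![\top]\!]=1$, $[\![\neg\varphi]\!]=1-[\![\varphi]\!]$, $[\![\varphi\wedge\psi]\!]=\min$, $[\![f_{iy}(\varphi_1,\ldots)]\!](x)=f_{iy}([\![\varphi_1]\!](x),\ldots)$,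 $[\![\diamond_a\varphi]\!](x)=c\int[\![\varphi]\!]d\gamma^0_{a,x}+(1-c)\gamma^1_{a,x}$. Theory map $\mathrm{th}\colon X\to[0,1]^{\mathcal L}$, $\mathrm{th}(x)(\varphi)=[\![\varphi]\!](x)$. It is topologisable by a topology $\tau$ on $\mathcal L$ if each $\mathrm{th}(x)$ is continuous on $(\mathcal L,\tau)$ and the preimage under $\mathrm{th}$ of every open subset of the space of continuous maps $(\mathcal L,\tau)\to[0,1]$ with the compact-open topology is universally measurable (lies in the completion of $\mathcal A$ w.r.t. every probability measure). *)

theory Defs
  imports "HOL-Probability.Probability"
begin

definition standard_borel :: "'a measure \<Rightarrow> bool" where
  "standard_borel M \<longleftrightarrow>
     (\<exists>T. completely_metrizable_space T \<and> separable_space T \<and>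
          space M = topspace T \<and> sets M = sigma_sets (topspace T) {U. openin T U})"

definition suslin :: "'a measure \<Rightarrow> 'a set \<Rightarrow> bool" where
  "suslin M S \<longleftrightarrow> (\<exists>E \<in> sets ((borel :: (nat \<Rightarrow> nat) measure) \<Otimes>\<^sub>M M). S = snd ` E)"

definition measurable_isomorphic :: "'a measure \<Rightarrow> 'b measure \<Rightarrow> bool" where
  "measurable_isomorphic M N \<longleftrightarrow>
     (\<exists>f \<in> M \<rightarrow>\<^sub>M N. \<exists>g \<in> N \<rightarrow>\<^sub>M M.
        (\<forall>x \<in> space M. g (f x) = x) \<and> (\<forall>y \<in> space N. f (g y) = y))"

text \<open>The definition of an analytic space quantifies existentially over standard Borel spaces of
  arbitrary type, which HOL cannot express. The carrier type of the ambient standard Borel space is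
  therefore a parameter; used as a hypothesis with a free type variable \<open>'b\<close>, the predicate
  covers ambient spaces of every type.\<close>

definition analytic_space :: "'b itself \<Rightarrow> 'a measure \<Rightarrow> bool" where
  "analytic_space (_ :: 'b itself) M \<longleftrightarrow>
     (\<exists>(B :: 'b measure) S. standard_borel B \<and> suslin B S \<and>
        measurable_isomorphic M (restrict_space B S))"

definition universally_measurable :: "'a measure \<Rightarrow> 'a set \<Rightarrow> bool" where
  "universally_measurable M S \<longleftrightarrow>
     (\<forall>\<mu>. prob_space \<mu> \<and> sets \<mu> = sets M \<longrightarrow> S \<in> sets (completion \<mu>))"

text \<open>Here \<open>\<gamma>0 a x\<close> is the transition probability and \<open>\<gamma>1 a x\<close> the reward.
  The \<open>\<sigma>\<close>-algebra of \<^const>\<open>prob_algebra\<close> is the one generated by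
  the evaluations \<open>\<mu> \<mapsto> \<mu>(U)\<close>.\<close>

definition markov_decision_process ::
  "'a measure \<Rightarrow> 's set \<Rightarrow> ('s \<Rightarrow> 'a \<Rightarrow> 'a measure) \<Rightarrow> ('s \<Rightarrow> 'a \<Rightarrow> real) \<Rightarrow> bool" where
  "markov_decision_process M \<Sigma> \<gamma>0 \<gamma>1 \<longleftrightarrow>
     (\<forall>a \<in> \<Sigma>. \<gamma>0 a \<in> M \<rightarrow>\<^sub>M prob_algebra M \<and>
        \<gamma>1 a \<in> borel_measurable M \<and> (\<forall>x \<in> space M. \<gamma>1 a x \<in> {0..1}))"

abbreviation unit_interval :: "real topology" where
  "unit_interval \<equiv> top_of_set {0..1}"

text \<open>Raw syntax; \<open>App i y \<phi>s\<close> is the function symbol \<open>f\<^sub>i\<^sub>y\<close> applied to a list of arguments.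
  The sets \<open>Y i\<close> all live in one type \<open>'y\<close>, which is no restriction, since a
  family of sets embeds into its disjoint union.\<close>

datatype ('s, 'y) fm =
    Top
  | Neg "('s, 'y) fm"
  | Conj "('s, 'y) fm" "('s, 'y) fm"
  | Dia 's "('s, 'y) fm"
  | App nat 'y "('s, 'y) fm list"

inductive_set language :: "'s set \<Rightarrow> (nat \<Rightarrow> 'y set) \<Rightarrow> (nat \<Rightarrow> nat) \<Rightarrow> ('s, 'y) fm set"
  for \<Sigma> :: "'s set" and Y :: "nat \<Rightarrow> 'y set" and n :: "nat \<Rightarrow> nat" where
  "Top \<in> language \<Sigma> Y n"
| "\<phi> \<in> language \<Sigma> Y n \<Longrightarrow> Neg \<phi> \<in> language \<Sigma> Y n"
| "\<phi> \<in> language \<Sigma> Y n \<Longrightarrow> \<psi> \<in> language \<Sigma> Y n \<Longrightarrow> Conj \<phi> \<psi> \<in> language \<Sigma> Y n"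
| "a \<in> \<Sigma> \<Longrightarrow> \<phi> \<in> language \<Sigma> Y n \<Longrightarrow> Dia a \<phi> \<in> language \<Sigma> Y n"
| "y \<in> Y i \<Longrightarrow> length \<phi>s = n i \<Longrightarrow> (\<forall>\<phi> \<in> set \<phi>s. \<phi> \<in> language \<Sigma> Y n) \<Longrightarrow>
     App i y \<phi>s \<in> language \<Sigma> Y n"

text \<open>Elements of \<open>[0,1]\<^sup>k\<close> are extensional functions on \<open>{..<k}\<close>, as in
  \<^const>\<open>product_topology\<close>.\<close>

primrec sem ::
  "real \<Rightarrow> ('s \<Rightarrow> 'a \<Rightarrow> 'a measure) \<Rightarrow> ('s \<Rightarrow> 'a \<Rightarrow> real) \<Rightarrow> (nat \<Rightarrow> 'y \<Rightarrow> (nat \<Rightarrow> real) \<Rightarrow> real) \<Rightarrow>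
   ('s, 'y) fm \<Rightarrow> 'a \<Rightarrow> real" where
  "sem c \<gamma>0 \<gamma>1 f Top = (\<lambda>x. 1)"
| "sem c \<gamma>0 \<gamma>1 f (Neg \<phi>) = (\<lambda>x. 1 - sem c \<gamma>0 \<gamma>1 f \<phi> x)"
| "sem c \<gamma>0 \<gamma>1 f (Conj \<phi> \<psi>) = (\<lambda>x. min (sem c \<gamma>0 \<gamma>1 f \<phi> x) (sem c \<gamma>0 \<gamma>1 f \<psi> x))"
| "sem c \<gamma>0 \<gamma>1 f (Dia a \<phi>) =
     (\<lambda>x. c * (\<integral>z. sem c \<gamma>0 \<gamma>1 f \<phi> z \<partial>(\<gamma>0 a x)) + (1 - c) * \<gamma>1 a x)"
| "sem c \<gamma>0 \<gamma>1 f (App i y \<phi>s) =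
     (\<lambda>x. f i y (\<lambda>k \<in> {..<length \<phi>s}. (map (sem c \<gamma>0 \<gamma>1 f) \<phi>s ! k) x))"

definition theory_map ::
  "('s, 'y) fm set \<Rightarrow> real \<Rightarrow> ('s \<Rightarrow> 'a \<Rightarrow> 'a measure) \<Rightarrow> ('s \<Rightarrow> 'a \<Rightarrow> real) \<Rightarrow>
   (nat \<Rightarrow> 'y \<Rightarrow> (nat \<Rightarrow> real) \<Rightarrow> real) \<Rightarrow> 'a \<Rightarrow> ('s, 'y) fm \<Rightarrow> real" where
  "theory_map L c \<gamma>0 \<gamma>1 f x = (\<lambda>\<phi> \<in> L. sem c \<gamma>0 \<gamma>1 f \<phi> x)"

text \<open>Maps are taken extensional, so that equality of maps is equality on \<^term>\<open>topspace T\<close>.\<close>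

definition continuous_maps :: "'a topology \<Rightarrow> 'b topology \<Rightarrow> ('a \<Rightarrow> 'b) set" where
  "continuous_maps T S = {h \<in> extensional (topspace T). continuous_map T S h}"

definition compact_open_topology :: "'a topology \<Rightarrow> 'b topology \<Rightarrow> ('a \<Rightarrow> 'b) topology" where
  "compact_open_topology T S =
     topology_generated_by
       {{h \<in> continuous_maps T S. h ` K \<subseteq> U} | K U. compactin T K \<and> openin S U}"

lemma topspace_compact_open_topology [simp]:
  "topspace (compact_open_topology T S) = continuous_maps T S"
proof -
  have "continuous_maps T S = {h \<in> continuous_maps T S. h ` {} \<subseteq> topspace S}"
    by simp
  then have "continuous_maps T S \<in>
      {{h \<in> continuous_maps T S. h ` K \<subseteq> U} | K U. compactin T K \<and> openin S U}"
    using compactin_empty openin_topspace by blast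
  then show ?thesis
    unfolding compact_open_topology_def topology_generated_by_topspace by blast
qed

definition topologisable_by ::
  "'a measure \<Rightarrow> 'l set \<Rightarrow> ('a \<Rightarrow> 'l \<Rightarrow> real) \<Rightarrow> 'l topology \<Rightarrow> bool" where
  "topologisable_by M L t T \<longleftrightarrow>
     topspace T = L \<and>
     (\<forall>x \<in> space M. continuous_map T unit_interval (t x)) \<and>
     (\<forall>W. openin (compact_open_topology T unit_interval) W \<longrightarrow>
        universally_measurable M (t -` W \<inter> space M))"

end

theory Submission
  imports Defs
begin

text \<open>Formulas of a fixed shape are parametrised by a finite product of the spaces \<open>\<tau> i\<close>, and there are
  countably many shapes; the topology on formulas is the disjoint sum of these products. For a fixed
  state the semantics is continuous in the formula, by dominated convergence at the modalities.

  If a map \<open>h\<close> sends a compact set \<open>K\<close> into an open set \<open>U\<close>, then \<open>K\<close> is covered by finitely many basic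
  open sets, each of which \<open>h\<close> sends into a closed rational interval contained in \<open>U\<close>. So every open
  set of the compact-open topology is a countable union of finite intersections of conditions of the
  form \<open>h ` V \<subseteq> {a..b}\<close>. By continuity such a condition only needs to be tested on a countable dense
  subset of \<open>V\<close>, hence it is measurable when pulled back along the theory map.\<close>

section \<open>Countability of formulas over countable parameter sets\<close>

instance fm :: (countable, countable) countable
  by countable_datatype

text \<open>Numbering the actions and the parameters injectively embeds the formulas into formulas
  over natural numbers, and these form a countable type. Injectivity is needed only on the atoms
  that occur, which is what \<open>fm.inj_map_strong\<close> asks for. The main use is with bases in
  place of the sets \<open>Y i\<close>, where it makes the base of the topology on formulas
  countable.\<close>

lemma countable_language:
  assumes "countable \<Sigma>" and "\<And>i. countable (Y i)"
  shows "countable (language \<Sigma> Y n)"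
proof -
  let ?S = "\<Union>i. Y i"
  have S: "countable ?S"
    using assms(2) by auto
  have "set1_fm \<phi> \<subseteq> \<Sigma> \<and> set2_fm \<phi> \<subseteq> ?S" if "\<phi> \<in> language \<Sigma> Y n" for \<phi>
    using that by induction auto
  then have sub: "language \<Sigma> Y n \<subseteq> {\<phi>. set1_fm \<phi> \<subseteq> \<Sigma> \<and> set2_fm \<phi> \<subseteq> ?S}"
    by auto
  have "inj_on (map_fm (to_nat_on \<Sigma>) (to_nat_on ?S)) {\<phi>. set1_fm \<phi> \<subseteq> \<Sigma> \<and> set2_fm \<phi> \<subseteq> ?S}"
  proof (rule inj_onI)
    fix \<phi> \<psi> :: "('a, 'b) fm"
    assume "\<phi> \<in> {\<phi>. set1_fm \<phi> \<subseteq> \<Sigma> \<and> set2_fm \<phi> \<subseteq> ?S}" "\<psi> \<in> {\<phi>. set1_fm \<phi> \<subseteq> \<Sigma> \<and> set2_fm \<phi> \<subseteq> ?S}"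
      and eq: "map_fm (to_nat_on \<Sigma>) (to_nat_on ?S) \<phi> = map_fm (to_nat_on \<Sigma>) (to_nat_on ?S) \<psi>"
    then have sub: "set1_fm \<phi> \<subseteq> \<Sigma>" "set2_fm \<phi> \<subseteq> ?S" "set1_fm \<psi> \<subseteq> \<Sigma>" "set2_fm \<psi> \<subseteq> ?S"
      by auto
    show "\<phi> = \<psi>"
    proof (rule fm.inj_map_strong[OF _ _ eq])
      show "z = z'" if "z \<in> set1_fm \<phi>" "z' \<in> set1_fm \<psi>" "to_nat_on \<Sigma> z = to_nat_on \<Sigma> z'" for z z'
        using that sub inj_onD[OF inj_on_to_nat_on[OF assms(1)]] by blast
      show "z = z'" if "z \<in> set2_fm \<phi>" "z' \<in> set2_fm \<psi>" "to_nat_on ?S z = to_nat_on ?S z'" for z z'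
        using that(3) subsetD[OF sub(2) that(1)] subsetD[OF sub(4) that(2)]
          inj_onD[OF inj_on_to_nat_on[OF S]] by blast
    qed
  qed
  then have "countable {\<phi>. set1_fm \<phi> \<subseteq> \<Sigma> \<and> set2_fm \<phi> \<subseteq> ?S}"
    using countableI_type countable_image_inj_on by blast
  then show ?thesis
    using sub countable_subset by blast
qed

section \<open>Patterns and their instances\<close>

text \<open>Replacing the parameters of a formula by sets of parameters gives a pattern, which stands for
  the product set of its instances. Patterns over bases form a base of the topology on formulas.\<close>

definition instances :: "('s, 'y set) fm \<Rightarrow> ('s, 'y) fm set" where
  "instances p = {\<phi>. rel_fm (=) (\<in>) \<phi> p}"

lemma instances_simps [simp]:
  "\<phi> \<in> instances Top \<longleftrightarrow> \<phi> = Top"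
  "\<phi> \<in> instances (Neg p) \<longleftrightarrow> (\<exists>\<phi>'. \<phi> = Neg \<phi>' \<and> \<phi>' \<in> instances p)"
  "\<phi> \<in> instances (Conj p q) \<longleftrightarrow> (\<exists>\<phi>' \<psi>'. \<phi> = Conj \<phi>' \<psi>' \<and> \<phi>' \<in> instances p \<and> \<psi>' \<in> instances q)"
  "\<phi> \<in> instances (Dia a p) \<longleftrightarrow> (\<exists>\<phi>'. \<phi> = Dia a \<phi>' \<and> \<phi>' \<in> instances p)"
  "\<phi> \<in> instances (App i V ps) \<longleftrightarrow>
     (\<exists>y \<phi>s. \<phi> = App i y \<phi>s \<and> y \<in> V \<and> list_all2 (\<lambda>\<phi> p. \<phi> \<in> instances p) \<phi>s ps)"
  by (cases \<phi>; auto simp: instances_def)+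

text \<open>Counterpart of \<open>instances_simps\<close>: there the pattern is known and the
  formula is analysed, here the formula is known. An instance has the same shape as its pattern, so
  the outermost constructor of the formula determines that of the pattern.\<close>

lemma constructor_in_instances_iff:
  "Top \<in> instances p \<longleftrightarrow> p = Top"
  "Neg \<phi> \<in> instances p \<longleftrightarrow> (\<exists>p'. p = Neg p' \<and> \<phi> \<in> instances p')"
  "Conj \<phi> \<psi> \<in> instances p \<longleftrightarrow> (\<exists>p' q'. p = Conj p' q' \<and> \<phi> \<in> instances p' \<and> \<psi> \<in> instances q')"
  "Dia a \<phi> \<in> instances p \<longleftrightarrow> (\<exists>p'. p = Dia a p' \<and> \<phi> \<in> instances p')"
  "App i y \<phi>s \<in> instances p \<longleftrightarrow>
     (\<exists>V ps. p = App i V ps \<and> y \<in> V \<and> list_all2 (\<lambda>\<phi> p. \<phi> \<in> instances p) \<phi>s ps)"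
  by (cases p; auto simp: instances_def)+

lemma constructor_in_language_iff [simp]:
  "Top \<in> language \<Sigma> Y n"
  "Neg \<phi> \<in> language \<Sigma> Y n \<longleftrightarrow> \<phi> \<in> language \<Sigma> Y n"
  "Conj \<phi> \<psi> \<in> language \<Sigma> Y n \<longleftrightarrow> \<phi> \<in> language \<Sigma> Y n \<and> \<psi> \<in> language \<Sigma> Y n"
  "Dia a \<phi> \<in> language \<Sigma> Y n \<longleftrightarrow> a \<in> \<Sigma> \<and> \<phi> \<in> language \<Sigma> Y n"
  "App i y \<phi>s \<in> language \<Sigma> Y n \<longleftrightarrow>
     y \<in> Y i \<and> length \<phi>s = n i \<and> (\<forall>\<phi> \<in> set \<phi>s. \<phi> \<in> language \<Sigma> Y n)"
  by (auto intro: language.intros elim: language.cases)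

text \<open>Serves the \<open>App\<close> cases of the inductions below: patterns found separately
  for the arguments are collected into one list. The side condition \<open>Q\<close> may depend on
  the position \<open>k\<close>, because it often refers to other lists at the same index.\<close>

lemma list_all2_choice:
  assumes "\<And>k. k < length xs \<Longrightarrow> \<exists>z. Q k z \<and> R (xs ! k) z"
  shows "\<exists>zs. list_all2 R xs zs \<and> (\<forall>k < length xs. Q k (zs ! k))"
proof -
  obtain z where "\<And>k. k < length xs \<Longrightarrow> Q k (z k) \<and> R (xs ! k) (z k)"
    using assms by metis
  then show ?thesis
    by (intro exI[of _ "map z [0..<length xs]"]) (auto simp: list_all2_conv_all_nth)
qed

section \<open>The topology on formulas\<close>

text \<open>The bases \<open>\<B> i\<close> are parameters of the locale so that patterns are
  literally formulas of the language whose symbols are indexed by base sets, and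
  \<open>language\<close> serves for both. The actions stay unchanged in a pattern, that is,
  \<open>\<Sigma>\<close> is treated as discrete.\<close>

locale formula_topology =
  fixes \<Sigma> :: "'s set" and n :: "nat \<Rightarrow> nat" and \<tau> :: "nat \<Rightarrow> 'y topology"
    and \<B> :: "nat \<Rightarrow> 'y set set"
  assumes countable_actions: "countable \<Sigma>"
    and countable_base: "\<And>i. countable (\<B> i)"
    and openin_base: "\<And>i V. V \<in> \<B> i \<Longrightarrow> openin (\<tau> i) V"
    and base: "\<And>i U y. openin (\<tau> i) U \<Longrightarrow> y \<in> U \<Longrightarrow> \<exists>V \<in> \<B> i. y \<in> V \<and> V \<subseteq> U"
    and Hausdorff: "\<And>i. Hausdorff_space (\<tau> i)"
begin

abbreviation formulas :: "('s, 'y) fm set" where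
  "formulas \<equiv> language \<Sigma> (\<lambda>i. topspace (\<tau> i)) n"

abbreviation patterns :: "('s, 'y set) fm set" where
  "patterns \<equiv> language \<Sigma> \<B> n"

lemma countable_patterns: "countable patterns"
  by (simp add: countable_language countable_actions countable_base)

lemma instances_subset_formulas:
  assumes "p \<in> patterns"
  shows "instances p \<subseteq> formulas"
  using assms
proof induction
  case (5 V i ps)
  then show ?case
    using openin_subset[OF openin_base[OF 5(1)]]
    by (fastforce simp: list_all2_conv_all_nth in_set_conv_nth)
qed force+

text \<open>Every parameter is enlarged to a base set around it. Thus the patterns cover the
  formulas; with \<open>patterns_directed\<close> this makes their instance sets a base of a
  topology.\<close>

lemma in_some_pattern:
  assumes "\<phi> \<in> formulas"
  shows "\<exists>p \<in> patterns. \<phi> \<in> instances p"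
  using assms
proof induction
  case (5 y i \<phi>s)
  then have "\<exists>p. p \<in> patterns \<and> \<phi>s ! k \<in> instances p" if "k < length \<phi>s" for k
    using that by auto
  then obtain ps where ps: "list_all2 (\<lambda>\<phi> p. \<phi> \<in> instances p) \<phi>s ps"
    "\<And>k. k < length \<phi>s \<Longrightarrow> ps ! k \<in> patterns"
    using list_all2_choice[of \<phi>s "\<lambda>_ p. p \<in> patterns" "\<lambda>\<phi> p. \<phi> \<in> instances p"] by blast
  obtain V where V: "V \<in> \<B> i" "y \<in> V"
    using base[OF openin_topspace 5(1)] by auto
  have "App i V ps \<in> patterns"
    using 5 V ps list_all2_lengthD[OF ps(1)]
    by (auto simp: in_set_conv_nth)
  then show ?case
    using V ps by (intro bexI[of _ "App i V ps"]) auto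
next
  case 1
  show ?case by (rule bexI[of _ Top]) auto
next
  case (2 \<phi>)
  then obtain p where "p \<in> patterns" "\<phi> \<in> instances p" by blast
  then show ?case by (intro bexI[of _ "Neg p"]) auto
next
  case (3 \<phi> \<psi>)
  then obtain p q where "p \<in> patterns" "\<phi> \<in> instances p" "q \<in> patterns" "\<psi> \<in> instances q" by blast
  then show ?case by (intro bexI[of _ "Conj p q"]) auto
next
  case (4 a \<phi>)
  then obtain p where "p \<in> patterns" "\<phi> \<in> instances p" by blast
  then show ?case using 4 by (intro bexI[of _ "Dia a p"]) auto
qed

text \<open>Two patterns with a common instance \<open>\<phi>\<close> both have the shape of
  \<open>\<phi>\<close>, so their intersection can be refined parameter by parameter: at each
  position a base set around the parameter of \<open>\<phi>\<close> fits into the intersection of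
  the two given base sets.\<close>

lemma patterns_directed:
  assumes "\<phi> \<in> formulas" and "p \<in> patterns" and "q \<in> patterns"
    and "\<phi> \<in> instances p" and "\<phi> \<in> instances q"
  shows "\<exists>r \<in> patterns. \<phi> \<in> instances r \<and> instances r \<subseteq> instances p \<inter> instances q"
  using assms
proof (induction arbitrary: p q)
  case 1
  then show ?case by (auto simp: constructor_in_instances_iff)
next
  case (2 \<phi>)
  then obtain p' q' where pq: "p = Neg p'" "q = Neg q'" "\<phi> \<in> instances p'" "\<phi> \<in> instances q'"
    by (auto simp: constructor_in_instances_iff)
  with 2 obtain r where "r \<in> patterns" "\<phi> \<in> instances r" "instances r \<subseteq> instances p' \<inter> instances q'"
    by (metis constructor_in_language_iff(2))
  with pq show ?case
    by (intro bexI[of _ "Neg r"]) force+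
next
  case (3 \<phi> \<psi>)
  then obtain p1 p2 q1 q2 where pq: "p = Conj p1 p2" "q = Conj q1 q2"
    "\<phi> \<in> instances p1" "\<phi> \<in> instances q1" "\<psi> \<in> instances p2" "\<psi> \<in> instances q2"
    by (auto simp: constructor_in_instances_iff)
  obtain r1 where "r1 \<in> patterns" "\<phi> \<in> instances r1" "instances r1 \<subseteq> instances p1 \<inter> instances q1"
    using 3 pq by (metis constructor_in_language_iff(3))
  moreover obtain r2 where "r2 \<in> patterns" "\<psi> \<in> instances r2" "instances r2 \<subseteq> instances p2 \<inter> instances q2"
    using 3 pq by (metis constructor_in_language_iff(3))
  ultimately show ?case
    using pq by (intro bexI[of _ "Conj r1 r2"]) force+
next
  case (4 a \<phi>)
  then obtain p' q' where pq: "p = Dia a p'" "q = Dia a q'" "\<phi> \<in> instances p'" "\<phi> \<in> instances q'"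
    by (auto simp: constructor_in_instances_iff)
  with 4 obtain r where "r \<in> patterns" "\<phi> \<in> instances r" "instances r \<subseteq> instances p' \<inter> instances q'"
    by (metis constructor_in_language_iff(4))
  with pq 4 show ?case
    by (intro bexI[of _ "Dia a r"]) force+
next
  case (5 y i \<phi>s)
  then obtain V ps W qs where pq: "p = App i V ps" "q = App i W qs" "y \<in> V" "y \<in> W"
    "list_all2 (\<lambda>\<phi> p. \<phi> \<in> instances p) \<phi>s ps" "list_all2 (\<lambda>\<phi> p. \<phi> \<in> instances p) \<phi>s qs"
    by (auto simp: constructor_in_instances_iff)
  have in_base: "V \<in> \<B> i" "W \<in> \<B> i" "set ps \<subseteq> patterns" "set qs \<subseteq> patterns"
    using 5(4,5) by (auto simp: pq)
  have len: "length ps = length \<phi>s" "length qs = length \<phi>s"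
    using pq list_all2_lengthD by metis+
  have "\<exists>r. (r \<in> patterns \<and> instances r \<subseteq> instances (ps ! k) \<inter> instances (qs ! k)) \<and>
      \<phi>s ! k \<in> instances r" if k: "k < length \<phi>s" for k
  proof -
    have "ps ! k \<in> patterns" "qs ! k \<in> patterns"
      using in_base len k by (auto simp: subset_iff)
    moreover have "\<phi>s ! k \<in> instances (ps ! k)" "\<phi>s ! k \<in> instances (qs ! k)"
      using pq k by (auto simp: list_all2_conv_all_nth)
    ultimately show ?thesis
      using 5(3) nth_mem[OF k] by blast
  qed
  then obtain rs where rs: "list_all2 (\<lambda>\<phi> p. \<phi> \<in> instances p) \<phi>s rs"
    "\<And>k. k < length \<phi>s \<Longrightarrow> rs ! k \<in> patterns \<and> instances (rs ! k) \<subseteq> instances (ps ! k) \<inter> instances (qs ! k)"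
    using list_all2_choice[of \<phi>s
        "\<lambda>k r. r \<in> patterns \<and> instances r \<subseteq> instances (ps ! k) \<inter> instances (qs ! k)"
        "\<lambda>\<phi> p. \<phi> \<in> instances p"] by blast
  obtain U where U: "U \<in> \<B> i" "y \<in> U" "U \<subseteq> V \<inter> W"
    using base[OF openin_Int[OF openin_base[OF in_base(1)] openin_base[OF in_base(2)]]] pq by blast
  have lenr: "length rs = length \<phi>s"
    using list_all2_lengthD[OF rs(1)] by simp
  have "App i U rs \<in> patterns"
    using 5(2) U rs lenr by (auto simp: in_set_conv_nth)
  moreover have "instances (App i U rs) \<subseteq> instances p \<inter> instances q"
  proof
    fix \<psi> assume "\<psi> \<in> instances (App i U rs)"
    then obtain y' \<psi>s where \<psi>s: "\<psi> = App i y' \<psi>s" "y' \<in> U" "list_all2 (\<lambda>\<phi> p. \<phi> \<in> instances p) \<psi>s rs"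
      by auto
    then have "length \<psi>s = length \<phi>s" "\<psi>s ! k \<in> instances (ps ! k) \<inter> instances (qs ! k)"
      if "k < length \<phi>s" for k
      using that rs(2)[OF that] lenr by (auto simp: list_all2_conv_all_nth)
    then show "\<psi> \<in> instances p \<inter> instances q"
      using U(3) \<psi>s lenr len unfolding pq by (auto simp: list_all2_conv_all_nth)
  qed
  ultimately show ?case
    using U rs(1) by (intro bexI[of _ "App i U rs"]) auto
qed

text \<open>Formulas of different shape, where the actions count as part of the shape, only lie in
  patterns of different shape, and these have no common instance. Formulas of equal shape differ in
  some parameter, where the Hausdorff property of the parameter space provides disjoint base sets; a
  product set is empty as soon as one factor is.\<close>

lemma patterns_separate:
  assumes "\<phi> \<in> formulas" and "\<psi> \<in> formulas" and "\<phi> \<noteq> \<psi>"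
  shows "\<exists>p \<in> patterns. \<exists>q \<in> patterns.
    \<phi> \<in> instances p \<and> \<psi> \<in> instances q \<and> instances p \<inter> instances q = {}"
proof -
  let ?sep = "\<lambda>\<phi> \<psi>. \<exists>p \<in> patterns. \<exists>q \<in> patterns.
    \<phi> \<in> instances p \<and> \<psi> \<in> instances q \<and> instances p \<inter> instances q = {}"
  \<comment> \<open>This settles all cases with different outermost constructors or actions: there
    any two patterns around the formulas are disjoint, so arbitrary ones can be taken.\<close>
  have unlike: "?sep \<phi> \<psi>" if "\<phi> \<in> formulas" "\<psi> \<in> formulas"
    and "\<And>p q. p \<in> patterns \<Longrightarrow> q \<in> patterns \<Longrightarrow> \<phi> \<in> instances p \<Longrightarrow> \<psi> \<in> instances q \<Longrightarrow>
      instances p \<inter> instances q = {}" for \<phi> \<psi>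
    using that in_some_pattern by meson
  show ?thesis
    using assms
  proof (induction arbitrary: \<psi>)
    case 1
    show ?case
      by (rule unlike[OF _ 1(1)]) (use 1(2) in \<open>cases \<psi>; auto simp: constructor_in_instances_iff\<close>)+
  next
    case (2 \<phi>)
    show ?case
    proof (cases "\<exists>\<psi>'. \<psi> = Neg \<psi>'")
      case True
      then obtain \<psi>' where \<psi>: "\<psi> = Neg \<psi>'" by blast
      with 2 obtain p q where "p \<in> patterns" "q \<in> patterns" "\<phi> \<in> instances p" "\<psi>' \<in> instances q"
        "instances p \<inter> instances q = {}"
        by (metis constructor_in_language_iff(2))
      with \<psi> show ?thesis
        by (intro bexI[of _ "Neg p"] bexI[of _ "Neg q"]) auto
    next
      case False
      show ?thesis
      proof (rule unlike[OF _ 2(3)])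
        show "Neg \<phi> \<in> formulas" using 2(1) by simp
      qed (use False in \<open>cases \<psi>; auto simp: constructor_in_instances_iff\<close>)
    qed
  next
    case (3 \<phi>1 \<phi>2)
    show ?case
    proof (cases "\<exists>\<psi>1 \<psi>2. \<psi> = Conj \<psi>1 \<psi>2")
      case True
      then obtain \<psi>1 \<psi>2 where \<psi>: "\<psi> = Conj \<psi>1 \<psi>2" by blast
      have \<psi>12: "\<psi>1 \<in> formulas" "\<psi>2 \<in> formulas"
        using 3 \<psi> by auto
      \<comment> \<open>Only one of the two components has to differ. The induction hypothesis
        separates that one, and arbitrary patterns are used around the other.\<close>
      obtain p1 p2 q1 q2 where pq: "p1 \<in> patterns" "\<phi>1 \<in> instances p1" "p2 \<in> patterns" "\<phi>2 \<in> instances p2"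
        "q1 \<in> patterns" "\<psi>1 \<in> instances q1" "q2 \<in> patterns" "\<psi>2 \<in> instances q2"
        "instances p1 \<inter> instances q1 = {} \<or> instances p2 \<inter> instances q2 = {}"
      proof (cases "\<phi>1 = \<psi>1")
        case True
        then have "\<phi>2 \<noteq> \<psi>2" using 3 \<psi> by auto
        then show ?thesis
          using 3(4)[OF \<psi>12(2)] in_some_pattern[OF 3(1)] in_some_pattern[OF \<psi>12(1)] that by blast
      next
        case False
        then show ?thesis
          using 3(3)[OF \<psi>12(1)] in_some_pattern[OF 3(2)] in_some_pattern[OF \<psi>12(2)] that by blast
      qed
      with \<psi> show ?thesis
        by (intro bexI[of _ "Conj p1 p2"] bexI[of _ "Conj q1 q2"]) auto
    next
      case False
      show ?thesis
      proof (rule unlike[OF _ 3(5)])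
        show "Conj \<phi>1 \<phi>2 \<in> formulas" using 3(1,2) by simp
      qed (use False in \<open>cases \<psi>; auto simp: constructor_in_instances_iff\<close>)
    qed
  next
    case (4 a \<phi>)
    show ?case
    proof (cases "\<exists>\<psi>'. \<psi> = Dia a \<psi>'")
      case True
      then obtain \<psi>' where \<psi>: "\<psi> = Dia a \<psi>'" by blast
      with 4 obtain p q where "p \<in> patterns" "q \<in> patterns" "\<phi> \<in> instances p" "\<psi>' \<in> instances q"
        "instances p \<inter> instances q = {}"
        by (metis constructor_in_language_iff(4))
      with \<psi> 4 show ?thesis
        by (intro bexI[of _ "Dia a p"] bexI[of _ "Dia a q"]) auto
    next
      case False
      show ?thesis
      proof (rule unlike[OF _ 4(4)])
        show "Dia a \<phi> \<in> formulas" using 4(1,2) by simp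
      qed (use False in \<open>cases \<psi>; auto simp: constructor_in_instances_iff\<close>)
    qed
  next
    case (5 y i \<phi>s)
    have \<phi>: "App i y \<phi>s \<in> formulas"
      using 5 by auto
    show ?case
    proof (cases "\<exists>y' \<psi>s. \<psi> = App i y' \<psi>s")
      case True
      then obtain y' \<psi>s where \<psi>: "\<psi> = App i y' \<psi>s" by blast
      then have \<psi>s: "y' \<in> topspace (\<tau> i)" "length \<psi>s = length \<phi>s" "\<forall>\<psi>\<in>set \<psi>s. \<psi> \<in> formulas"
        using 5 by auto
      \<comment> \<open>The two symbols may coincide while the arguments differ, so disjointness is
        demanded only for distinct symbols. The arguments are handled in the same conditional way
        below.\<close>
      have "\<exists>V\<in>\<B> i. \<exists>W\<in>\<B> i. y \<in> V \<and> y' \<in> W \<and> (y \<noteq> y' \<longrightarrow> V \<inter> W = {})"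
      proof (cases "y = y'")
        case True
        then show ?thesis
          using base[OF openin_topspace \<psi>s(1)] by blast
      next
        case False
        then obtain V W where VW: "openin (\<tau> i) V" "openin (\<tau> i) W" "y \<in> V" "y' \<in> W" "disjnt V W"
          using Hausdorff[of i] 5(1) \<psi>s(1) unfolding Hausdorff_space_def by metis
        obtain V' where "V' \<in> \<B> i" "y \<in> V'" "V' \<subseteq> V" using base VW by blast
        moreover obtain W' where "W' \<in> \<B> i" "y' \<in> W'" "W' \<subseteq> W" using base VW by blast
        ultimately show ?thesis using VW unfolding disjnt_def by blast
      qed
      then obtain V W where VW: "V \<in> \<B> i" "W \<in> \<B> i" "y \<in> V" "y' \<in> W" "y \<noteq> y' \<longrightarrow> V \<inter> W = {}"
        by blast
      \<comment> \<open>Patterns for both formulas are chosen as pairs, so that one application of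
        \<open>list_all2_choice\<close> yields both argument lists with matching disjointness
        information.\<close>
      have "\<exists>pq. (fst pq \<in> patterns \<and> snd pq \<in> patterns \<and> \<psi>s ! k \<in> instances (snd pq) \<and>
          (\<phi>s ! k \<noteq> \<psi>s ! k \<longrightarrow> instances (fst pq) \<inter> instances (snd pq) = {})) \<and>
          \<phi>s ! k \<in> instances (fst pq)" if k: "k < length \<phi>s" for k
      proof -
        have mem: "\<phi>s ! k \<in> set \<phi>s" "\<psi>s ! k \<in> formulas"
          using k \<psi>s by auto
        show ?thesis
        proof (cases "\<phi>s ! k = \<psi>s ! k")
          case True
          then show ?thesis using in_some_pattern[OF mem(2)] by auto
        next
          case False
          then obtain p q where "p \<in> patterns" "q \<in> patterns" "\<phi>s ! k \<in> instances p"
            "\<psi>s ! k \<in> instances q" "instances p \<inter> instances q = {}"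
            using 5(3) mem by meson
          then show ?thesis by (intro exI[of _ "(p, q)"]) auto
        qed
      qed
      then obtain rs where rs: "list_all2 (\<lambda>\<phi> pq. \<phi> \<in> instances (fst pq)) \<phi>s rs"
        "\<And>k. k < length \<phi>s \<Longrightarrow> fst (rs ! k) \<in> patterns \<and> snd (rs ! k) \<in> patterns \<and>
          \<psi>s ! k \<in> instances (snd (rs ! k)) \<and>
          (\<phi>s ! k \<noteq> \<psi>s ! k \<longrightarrow> instances (fst (rs ! k)) \<inter> instances (snd (rs ! k)) = {})"
        using list_all2_choice[of \<phi>s
            "\<lambda>k pq. fst pq \<in> patterns \<and> snd pq \<in> patterns \<and> \<psi>s ! k \<in> instances (snd pq) \<and>
              (\<phi>s ! k \<noteq> \<psi>s ! k \<longrightarrow> instances (fst pq) \<inter> instances (snd pq) = {})"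
            "\<lambda>\<phi> pq. \<phi> \<in> instances (fst pq)"] by blast
      have len: "length rs = length \<phi>s"
        using list_all2_lengthD[OF rs(1)] by simp
      have "fst r \<in> patterns \<and> snd r \<in> patterns" if "r \<in> set rs" for r
        using that rs(2) len by (metis in_set_conv_nth)
      then have pats: "App i V (map fst rs) \<in> patterns" "App i W (map snd rs) \<in> patterns"
        using VW(1,2) len 5(2) by auto
      have inst: "App i y \<phi>s \<in> instances (App i V (map fst rs))" "\<psi> \<in> instances (App i W (map snd rs))"
        using VW(3,4) rs len \<psi> \<psi>s(2) by (auto simp: list_all2_conv_all_nth)
      have "instances (App i V (map fst rs)) \<inter> instances (App i W (map snd rs)) = {}"
      proof (cases "y = y'")
        case True
        then have "\<phi>s \<noteq> \<psi>s" using 5 \<psi> by auto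
        then obtain k where k: "k < length \<phi>s" "\<phi>s ! k \<noteq> \<psi>s ! k"
          using \<psi>s(2) nth_equalityI by metis
        then have "instances (fst (rs ! k)) \<inter> instances (snd (rs ! k)) = {}"
          using rs by auto
        moreover have "\<chi>s ! k \<in> instances (fst (rs ! k)) \<inter> instances (snd (rs ! k))"
          if "list_all2 (\<lambda>\<phi> p. \<phi> \<in> instances p) \<chi>s (map fst rs)"
            "list_all2 (\<lambda>\<phi> p. \<phi> \<in> instances p) \<chi>s (map snd rs)" for \<chi>s
          using that k len by (auto simp: list_all2_conv_all_nth)
        ultimately show ?thesis by auto
      next
        case False
        then show ?thesis using VW by auto
      qed
      with pats inst show ?thesis by blast
    next
      case False
      show ?thesis
      proof (rule unlike[OF _ 5(4)])
        show "App i y \<phi>s \<in> formulas" using \<phi> by simp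
      qed (use False in \<open>cases \<psi>; auto simp: constructor_in_instances_iff\<close>)
    qed
  qed
qed

text \<open>Openness is expressed by a pattern around each point instead of by shapes and products.
  The patterns then form a base by definition, and continuity at a formula amounts to finding a
  single pattern.\<close>

definition formula_top :: "('s, 'y) fm topology" where
  "formula_top = topology (\<lambda>U. U \<subseteq> formulas \<and>
     (\<forall>\<phi> \<in> U. \<exists>p \<in> patterns. \<phi> \<in> instances p \<and> instances p \<subseteq> U))"

lemma openin_formula_top:
  "openin formula_top U \<longleftrightarrow> U \<subseteq> formulas \<and>
     (\<forall>\<phi> \<in> U. \<exists>p \<in> patterns. \<phi> \<in> instances p \<and> instances p \<subseteq> U)"
proof -
  have "istopology (\<lambda>U. U \<subseteq> formulas \<and>
     (\<forall>\<phi> \<in> U. \<exists>p \<in> patterns. \<phi> \<in> instances p \<and> instances p \<subseteq> U))" (is "istopology ?open")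
    unfolding istopology_def
  proof (intro conjI allI impI)
    fix U V
    assume U: "?open U" and V: "?open V"
    show "\<forall>\<phi> \<in> U \<inter> V. \<exists>p \<in> patterns. \<phi> \<in> instances p \<and> instances p \<subseteq> U \<inter> V"
    proof
      fix \<phi> assume \<phi>: "\<phi> \<in> U \<inter> V"
      obtain p where p: "p \<in> patterns" "\<phi> \<in> instances p" "instances p \<subseteq> U"
        using \<phi> U by blast
      obtain q where q: "q \<in> patterns" "\<phi> \<in> instances q" "instances q \<subseteq> V"
        using \<phi> V by blast
      have "\<phi> \<in> formulas" using \<phi> U by blast
      from patterns_directed[OF this p(1) q(1) p(2) q(2)] p q
      show "\<exists>p \<in> patterns. \<phi> \<in> instances p \<and> instances p \<subseteq> U \<inter> V" by blast
    qed
  next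
    fix K
    assume K: "\<forall>U \<in> K. ?open U"
    show "\<forall>\<phi> \<in> \<Union> K. \<exists>p \<in> patterns. \<phi> \<in> instances p \<and> instances p \<subseteq> \<Union> K"
    proof
      fix \<phi> assume "\<phi> \<in> \<Union> K"
      then obtain U where "U \<in> K" "\<phi> \<in> U" by blast
      moreover from this obtain p where "p \<in> patterns" "\<phi> \<in> instances p" "instances p \<subseteq> U"
        using K by blast
      ultimately show "\<exists>p \<in> patterns. \<phi> \<in> instances p \<and> instances p \<subseteq> \<Union> K"
        by blast
    qed
  qed blast+
  then show ?thesis
    unfolding formula_top_def by simp
qed

lemma openin_instances: "p \<in> patterns \<Longrightarrow> openin formula_top (instances p)"
  using instances_subset_formulas unfolding openin_formula_top by blast

lemma topspace_formula_top [simp]: "topspace formula_top = formulas"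
proof -
  have "openin formula_top formulas"
    using in_some_pattern instances_subset_formulas unfolding openin_formula_top by blast
  then show ?thesis
    using openin_formula_top[THEN iffD1, OF openin_topspace] openin_subset by blast
qed

lemma second_countable_formula_top: "second_countable formula_top"
  unfolding second_countable_def
proof (intro exI[of _ "instances ` patterns"] conjI)
  show "countable (instances ` patterns)"
    by (simp add: countable_patterns)
  show "\<forall>V \<in> instances ` patterns. openin formula_top V"
    using openin_instances by blast
qed (simp add: openin_formula_top)

lemma Hausdorff_formula_top: "Hausdorff_space formula_top"
  unfolding Hausdorff_space_def
proof (intro allI impI)
  fix \<phi> \<psi>
  assume "\<phi> \<in> topspace formula_top \<and> \<psi> \<in> topspace formula_top \<and> \<phi> \<noteq> \<psi>"
  then obtain p q where "p \<in> patterns" "q \<in> patterns" "\<phi> \<in> instances p" "\<psi> \<in> instances q"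
    "instances p \<inter> instances q = {}"
    using patterns_separate[of \<phi> \<psi>] by auto
  then show "\<exists>U V. openin formula_top U \<and> openin formula_top V \<and> \<phi> \<in> U \<and> \<psi> \<in> V \<and> disjnt U V"
    using openin_instances unfolding disjnt_def by blast
qed

end

section \<open>Continuity of integrals in a parameter\<close>

text \<open>Dominated convergence speaks about sequences, so first countability is used to reduce to
  them: if the claim failed, points with integrals at distance at least \<open>\<epsilon>\<close>
  could be picked from shrinking neighbourhoods of \<open>a\<close>. Their integrands converge
  pointwise and are dominated by the constant \<open>C\<close>, which is integrable for a finite
  measure.\<close>

lemma integral_continuous_at:
  fixes g :: "'l \<Rightarrow> 'a \<Rightarrow> real"
  assumes "finite_measure \<mu>" and "first_countable T" and a: "a \<in> topspace T"
    and meas: "\<And>\<phi>. \<phi> \<in> topspace T \<Longrightarrow> g \<phi> \<in> borel_measurable \<mu>"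
    and bound: "\<And>\<phi> z. \<phi> \<in> topspace T \<Longrightarrow> z \<in> space \<mu> \<Longrightarrow> \<bar>g \<phi> z\<bar> \<le> C"
    and cont: "\<And>z \<epsilon>. z \<in> space \<mu> \<Longrightarrow> \<epsilon> > 0 \<Longrightarrow>
      \<exists>U. openin T U \<and> a \<in> U \<and> (\<forall>\<phi> \<in> U. \<bar>g \<phi> z - g a z\<bar> < \<epsilon>)"
    and "\<epsilon> > 0"
  shows "\<exists>U. openin T U \<and> a \<in> U \<and> (\<forall>\<phi> \<in> U. \<bar>(\<integral>z. g \<phi> z \<partial>\<mu>) - (\<integral>z. g a z \<partial>\<mu>)\<bar> < \<epsilon>)"
proof (rule ccontr)
  interpret finite_measure \<mu> by fact
  assume contra: "\<not> ?thesis"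
  obtain \<C> where \<C>: "countable \<C>" "\<And>V. V \<in> \<C> \<Longrightarrow> openin T V"
    "\<And>U. openin T U \<Longrightarrow> a \<in> U \<Longrightarrow> \<exists>V \<in> \<C>. a \<in> V \<and> V \<subseteq> U"
    using assms(2) a unfolding first_countable_def by metis
  \<comment> \<open>Members of \<open>\<C>\<close> need not contain \<open>a\<close>; those that do
    form a neighbourhood base at \<open>a\<close>.\<close>
  define \<D> where "\<D> = {V \<in> \<C>. a \<in> V}"
  have \<D>: "countable \<D>" "\<D> \<noteq> {}"
    using \<C>(1) \<C>(3)[OF openin_topspace a] unfolding \<D>_def by auto
  \<comment> \<open>Finite intersections along an enumeration of \<open>\<D>\<close> give decreasing
    open neighbourhoods. If \<open>\<D>\<close> is finite, \<open>from_nat_into\<close> repeats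
    members, which does no harm.\<close>
  define W where "W k = (\<Inter>j\<le>k. from_nat_into \<D> j)" for k :: nat
  have W: "openin T (W k)" "a \<in> W k" for k
    using from_nat_into[OF \<D>(2)] \<C>(2) unfolding W_def \<D>_def by (auto intro!: openin_Inter)
  then have "\<forall>k. \<exists>\<phi> \<in> W k. \<not> \<bar>(\<integral>z. g \<phi> z \<partial>\<mu>) - (\<integral>z. g a z \<partial>\<mu>)\<bar> < \<epsilon>"
    using contra by blast
  then obtain \<phi> where \<phi>: "\<And>k. \<phi> k \<in> W k"
    "\<And>k. \<not> \<bar>(\<integral>z. g (\<phi> k) z \<partial>\<mu>) - (\<integral>z. g a z \<partial>\<mu>)\<bar> < \<epsilon>"
    by metis
  have in_T: "\<phi> k \<in> topspace T" for k
    using \<phi>(1) W(1) openin_subset by blast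
  have "(\<lambda>k. g (\<phi> k) z) \<longlonglongrightarrow> g a z" if z: "z \<in> space \<mu>" for z
  proof (rule LIMSEQ_I)
    fix r :: real assume "r > 0"
    then obtain U where U: "openin T U" "a \<in> U" "\<And>\<psi>. \<psi> \<in> U \<Longrightarrow> \<bar>g \<psi> z - g a z\<bar> < r"
      using cont[OF z] by metis
    then obtain V where "V \<in> \<D>" "V \<subseteq> U"
      using \<C>(3) unfolding \<D>_def by blast
    then obtain j where "from_nat_into \<D> j \<subseteq> U"
      using from_nat_into_surj[OF \<D>(1)] by metis
    then have "\<phi> k \<in> U" if "k \<ge> j" for k
      using \<phi>(1)[of k] that unfolding W_def by blast
    then show "\<exists>j. \<forall>k\<ge>j. norm (g (\<phi> k) z - g a z) < r"
      using U(3) by auto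
  qed
  then have "(\<lambda>k. \<integral>z. g (\<phi> k) z \<partial>\<mu>) \<longlonglongrightarrow> (\<integral>z. g a z \<partial>\<mu>)"
    using meas a in_T bound
    by (intro integral_dominated_convergence[where w = "\<lambda>_. C"]) auto
  then obtain k where "\<bar>(\<integral>z. g (\<phi> k) z \<partial>\<mu>) - (\<integral>z. g a z \<partial>\<mu>)\<bar> < \<epsilon>"
    using LIMSEQ_D[OF _ \<open>\<epsilon> > 0\<close>] by fastforce
  with \<phi>(2) show False by blast
qed

section \<open>A countable network for the compact-open topology and measurable preimages\<close>

lemma compact_open_network:
  fixes T :: "'l topology"
  assumes base: "\<And>U \<phi>. openin T U \<Longrightarrow> \<phi> \<in> U \<Longrightarrow> \<exists>V \<in> \<C>. \<phi> \<in> V \<and> V \<subseteq> U"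
    and open_base: "\<And>V. V \<in> \<C> \<Longrightarrow> openin T V"
    and W: "openin (compact_open_topology T unit_interval) W"
    and h: "h \<in> W"
  shows "\<exists>F. finite F \<and> F \<subseteq> \<C> \<times> \<rat> \<times> \<rat> \<and> (\<forall>(V, a, b) \<in> F. h ` V \<subseteq> {a..b}) \<and>
    {h \<in> continuous_maps T unit_interval. \<forall>(V, a, b) \<in> F. h ` V \<subseteq> {a..b}} \<subseteq> W"
proof -
  let ?N = "\<lambda>F. {h \<in> continuous_maps T unit_interval. \<forall>(V, a, b) \<in> F. h ` V \<subseteq> {a..b}}"
  have "generate_topology_on
      {{h \<in> continuous_maps T unit_interval. h ` K \<subseteq> U} | K U. compactin T K \<and> openin unit_interval U} W"
    using W unfolding compact_open_topology_def openin_topology_generated_by_iff .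
  then have "\<forall>h \<in> W. \<exists>F. finite F \<and> F \<subseteq> \<C> \<times> \<rat> \<times> \<rat> \<and>
    (\<forall>(V, a, b) \<in> F. h ` V \<subseteq> {a..b}) \<and> ?N F \<subseteq> W"
  proof induction
    case Empty
    then show ?case by blast
  next
    case (Int W1 W2)
    show ?case
    proof
      fix h assume h: "h \<in> W1 \<inter> W2"
      obtain F1 where F1: "finite F1" "F1 \<subseteq> \<C> \<times> \<rat> \<times> \<rat>" "\<forall>(V, a, b) \<in> F1. h ` V \<subseteq> {a..b}" "?N F1 \<subseteq> W1"
        using bspec[OF Int.IH(1) IntD1[OF h]] by (elim exE conjE)
      obtain F2 where F2: "finite F2" "F2 \<subseteq> \<C> \<times> \<rat> \<times> \<rat>" "\<forall>(V, a, b) \<in> F2. h ` V \<subseteq> {a..b}" "?N F2 \<subseteq> W2"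
        using bspec[OF Int.IH(2) IntD2[OF h]] by (elim exE conjE)
      have "?N (F1 \<union> F2) \<subseteq> ?N F1 \<inter> ?N F2"
        by blast
      also have "\<dots> \<subseteq> W1 \<inter> W2"
        using F1(4) F2(4) by (rule Int_mono)
      finally have "?N (F1 \<union> F2) \<subseteq> W1 \<inter> W2" .
      moreover have "finite (F1 \<union> F2)" "F1 \<union> F2 \<subseteq> \<C> \<times> \<rat> \<times> \<rat>"
        using F1(1,2) F2(1,2) by auto
      moreover have "\<forall>(V, a, b) \<in> F1 \<union> F2. h ` V \<subseteq> {a..b}"
        using F1(3) F2(3) by (simp add: ball_Un)
      ultimately show "\<exists>F. finite F \<and> F \<subseteq> \<C> \<times> \<rat> \<times> \<rat> \<and>
          (\<forall>(V, a, b) \<in> F. h ` V \<subseteq> {a..b}) \<and> ?N F \<subseteq> W1 \<inter> W2"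
        by (intro exI[of _ "F1 \<union> F2"] conjI)
    qed
  next
    case (UN K)
    show ?case
    proof
      fix h assume "h \<in> \<Union> K"
      then obtain k where k: "k \<in> K" "h \<in> k" by blast
      obtain F where F: "finite F" "F \<subseteq> \<C> \<times> \<rat> \<times> \<rat>" "\<forall>(V, a, b) \<in> F. h ` V \<subseteq> {a..b}" "?N F \<subseteq> k"
        using bspec[OF UN.IH[OF k(1)] k(2)] by (elim exE conjE)
      have "?N F \<subseteq> \<Union> K"
        using F(4) Union_upper[OF k(1)] by (rule subset_trans)
      with F(1-3) show "\<exists>F. finite F \<and> F \<subseteq> \<C> \<times> \<rat> \<times> \<rat> \<and>
          (\<forall>(V, a, b) \<in> F. h ` V \<subseteq> {a..b}) \<and> ?N F \<subseteq> \<Union> K"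
        by (intro exI[of _ F] conjI)
    qed
  next
    case (Basis G)
    then obtain K U where G: "G = {h \<in> continuous_maps T unit_interval. h ` K \<subseteq> U}"
      and K: "compactin T K" and "openin unit_interval U"
      by blast
    \<comment> \<open>The rational endpoints may lie outside the unit interval, so the intervals are
      compared with an open set \<open>U'\<close> of reals. Values in \<open>{0..1}\<close> come
      from the continuous maps themselves.\<close>
    then obtain U' where U': "open U'" "U = U' \<inter> {0..1}"
      by (metis Int_commute openin_open)
    show ?case
    proof
      fix h assume hG: "h \<in> G"
      then have h: "continuous_map T unit_interval h" and hK: "h ` K \<subseteq> U"
        by (auto simp: G continuous_maps_def)
      \<comment> \<open>All conditions that \<open>h\<close> satisfies and that force any other map
        into \<open>U'\<close> on \<open>V\<close>.\<close>
      define \<F> where "\<F> = {(V, a, b). V \<in> \<C> \<and> a \<in> \<rat> \<and> b \<in> \<rat> \<and> h ` V \<subseteq> {a..b} \<and> {a..b} \<subseteq> U'}"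
      have cover: "\<exists>(V, a, b) \<in> \<F>. \<phi> \<in> V" if \<phi>: "\<phi> \<in> K" for \<phi>
      proof -
        have "h \<phi> \<in> U'" using hK \<phi> U' by auto
        then obtain e where e: "e > 0" "\<And>z. dist z (h \<phi>) < e \<Longrightarrow> z \<in> U'"
          using U'(1) unfolding open_dist by blast
        \<comment> \<open>The endpoints are strictly on either side of \<open>h \<phi>\<close>, so
          the preimage of the open interval is a neighbourhood of \<open>\<phi>\<close>, and they
          are within \<open>e\<close> of it, so the closed interval stays in
          \<open>U'\<close>.\<close>
        obtain a where a: "a \<in> \<rat>" "h \<phi> - e < a" "a < h \<phi>"
          using Rats_dense_in_real[of "h \<phi> - e" "h \<phi>"] e by auto
        obtain b where b: "b \<in> \<rat>" "h \<phi> < b" "b < h \<phi> + e"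
          using Rats_dense_in_real[of "h \<phi>" "h \<phi> + e"] e by auto
        have "openin T {\<psi> \<in> topspace T. h \<psi> \<in> {0..1} \<inter> {a<..<b}}"
          using openin_continuous_map_preimage[OF h, of "{0..1} \<inter> {a<..<b}"] by (simp add: openin_open_Int)
        moreover have "\<phi> \<in> {\<psi> \<in> topspace T. h \<psi> \<in> {0..1} \<inter> {a<..<b}}"
          using \<phi> compactin_subset_topspace[OF K] a b continuous_map_image_subset_topspace[OF h]
          by (auto simp: image_subset_iff subset_iff)
        ultimately obtain V where V: "V \<in> \<C>" "\<phi> \<in> V"
          "V \<subseteq> {\<psi> \<in> topspace T. h \<psi> \<in> {0..1} \<inter> {a<..<b}}"
          using base by meson
        moreover have "h ` V \<subseteq> {a..b}" using V(3) by force
        moreover have "{a..b} \<subseteq> U'" using e(2) a b by (auto simp: dist_real_def)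
        ultimately show ?thesis using a b unfolding \<F>_def by blast
      qed
      have "K \<subseteq> \<Union> (fst ` \<F>)"
        using cover by force
      moreover have "\<And>V. V \<in> fst ` \<F> \<Longrightarrow> openin T V"
        using open_base unfolding \<F>_def by auto
      ultimately obtain \<V> where \<V>: "finite \<V>" "\<V> \<subseteq> fst ` \<F>" "K \<subseteq> \<Union> \<V>"
        using compactinD[OF K, of "fst ` \<F>"] by metis
      \<comment> \<open>The finite subcover consists of first components; this returns to a finite
        set of full conditions with the same first components.\<close>
      from finite_subset_image[OF \<V>(1,2)]
      obtain F where F: "F \<subseteq> \<F>" "finite F" "\<V> = fst ` F"
        by blast
      have "?N F \<subseteq> G"
      proof
        fix h' assume h': "h' \<in> ?N F"
        then have "continuous_map T unit_interval h'"
          by (simp add: continuous_maps_def)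
        then have "h' ` topspace T \<subseteq> {0..1}"
          using continuous_map_image_subset_topspace by force
        moreover have "h' \<phi> \<in> U'" if "\<phi> \<in> K" for \<phi>
        proof -
          obtain V a b where Vab: "(V, a, b) \<in> F" "\<phi> \<in> V"
            using subsetD[OF \<V>(3) \<open>\<phi> \<in> K\<close>] F(3) by auto
          then have "{a..b} \<subseteq> U'"
            using F(1) unfolding \<F>_def by blast
          moreover have "h' ` V \<subseteq> {a..b}"
            using h' Vab(1) by blast
          ultimately show ?thesis
            using Vab(2) by blast
        qed
        ultimately show "h' \<in> G"
          using h' compactin_subset_topspace[OF K] unfolding G U'(2) by blast
      qed
      moreover have "F \<subseteq> \<C> \<times> \<rat> \<times> \<rat>" "\<forall>(V, a, b) \<in> F. h ` V \<subseteq> {a..b}"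
        using F(1) unfolding \<F>_def by blast+
      ultimately show "\<exists>F. finite F \<and> F \<subseteq> \<C> \<times> \<rat> \<times> \<rat> \<and>
          (\<forall>(V, a, b) \<in> F. h ` V \<subseteq> {a..b}) \<and> ?N F \<subseteq> G"
        using F(2) by (intro exI[of _ F] conjI)
    qed
  qed
  then show ?thesis using h by (rule bspec)
qed

text \<open>There are only countably many finite sets of conditions over a countable base and
  rational endpoints. Hence \<open>W\<close> is a countable union of network sets, and it is enough
  that each single condition pulls back to a measurable set.\<close>

lemma compact_open_preimage_measurable:
  assumes "second_countable T"
    and cont: "\<And>x. x \<in> space M \<Longrightarrow> t x \<in> continuous_maps T unit_interval"
    and meas: "\<And>\<phi>. \<phi> \<in> topspace T \<Longrightarrow> (\<lambda>x. t x \<phi>) \<in> borel_measurable M"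
    and W: "openin (compact_open_topology T unit_interval) W"
  shows "t -` W \<inter> space M \<in> sets M"
proof -
  obtain \<C> where \<C>: "countable \<C>" "\<And>V. V \<in> \<C> \<Longrightarrow> openin T V"
    "\<And>U \<phi>. openin T U \<Longrightarrow> \<phi> \<in> U \<Longrightarrow> \<exists>V \<in> \<C>. \<phi> \<in> V \<and> V \<subseteq> U"
    using assms(1) unfolding second_countable_def by auto
  define E where "E = (\<lambda>(V, a, b). {x \<in> space M. t x ` V \<subseteq> {a..b :: real}})"
  have E: "E (V, a, b) \<in> sets M" if V: "V \<in> \<C>" for V a b
  proof -
    \<comment> \<open>One chosen point from every nonempty trace on \<open>V\<close> of a base set:
      a countable dense subset of \<open>V\<close>.\<close>
    define D where "D = (\<lambda>V'. SOME d. d \<in> V' \<inter> V) ` {V' \<in> \<C>. V' \<inter> V \<noteq> {}}"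
    have D_in: "(SOME d. d \<in> V' \<inter> V) \<in> V' \<inter> V" if "V' \<inter> V \<noteq> {}" for V'
      by (rule someI_ex) (use that in blast)
    have D: "countable D" "D \<subseteq> V"
      using \<C>(1) D_in unfolding D_def by auto
    have V_sub: "V \<subseteq> topspace T"
      using openin_subset \<C>(2) V by blast
    have "t x ` V \<subseteq> {a..b}" if x: "x \<in> space M" and D_ab: "\<And>d. d \<in> D \<Longrightarrow> t x d \<in> {a..b}" for x
    proof (rule ccontr)
      assume "\<not> t x ` V \<subseteq> {a..b}"
      then obtain \<phi> where \<phi>: "\<phi> \<in> V" "t x \<phi> \<notin> {a..b}" by blast
      have tx: "continuous_map T unit_interval (t x)"
        using cont[OF x] by (simp add: continuous_maps_def)
      have "openin unit_interval ({0..1} \<inter> - {a..b})"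
        by (intro openin_open_Int open_Compl closed_atLeastAtMost)
      then have "openin T {\<psi> \<in> topspace T. t x \<psi> \<in> {0..1} \<inter> - {a..b}}"
        by (rule openin_continuous_map_preimage[OF tx])
      moreover have "\<phi> \<in> {\<psi> \<in> topspace T. t x \<psi> \<in> {0..1} \<inter> - {a..b}}"
        using \<phi> V_sub continuous_map_image_subset_topspace[OF tx]
        by (auto simp: image_subset_iff subset_iff)
      ultimately obtain V' where V': "V' \<in> \<C>" "\<phi> \<in> V'"
        "V' \<subseteq> {\<psi> \<in> topspace T. t x \<psi> \<in> {0..1} \<inter> - {a..b}}"
        using \<C>(3) by meson
      \<comment> \<open>On all of \<open>V'\<close> the map \<open>t x\<close> avoids
        \<open>{a..b}\<close>, yet \<open>V'\<close> contains the point of \<open>D\<close> chosen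
        for it.\<close>
      then have "V' \<inter> V \<noteq> {}" using \<phi> by blast
      with V' D_in[OF this] D_ab[of "SOME d. d \<in> V' \<inter> V"] show False
        unfolding D_def by blast
    qed
    then have "E (V, a, b) = {x \<in> space M. \<forall>d \<in> D. t x d \<in> {a..b}}"
      using D(2) unfolding E_def prod.case by blast
    moreover have "{x \<in> space M. \<forall>d \<in> D. t x d \<in> {a..b}} \<in> sets M"
    proof (rule sets.sets_Collect_countable_All'[OF _ D(1)])
      fix d assume "d \<in> D"
      then have [measurable]: "(\<lambda>x. t x d) \<in> borel_measurable M"
        using meas D(2) V_sub by blast
      show "{x \<in> space M. t x d \<in> {a..b}} \<in> sets M" by measurable
    qed
    ultimately show ?thesis by simp
  qed
  \<comment> \<open>This family depends on \<open>W\<close> alone and not on a map \<open>h\<close>,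
    which is what makes the union below countable.\<close>
  define \<F> where "\<F> = {F. finite F \<and> F \<subseteq> \<C> \<times> \<rat> \<times> \<rat> \<and>
    {h \<in> continuous_maps T unit_interval. \<forall>(V, a, b) \<in> F. h ` V \<subseteq> {a..b}} \<subseteq> W}"
  have "countable {F. finite F \<and> F \<subseteq> \<C> \<times> (\<rat> :: real set) \<times> (\<rat> :: real set)}"
    using \<C>(1) countable_rat by (intro countable_Collect_finite_subset countable_SIGMA) auto
  then have "countable \<F>"
    by (rule countable_subset[rotated]) (auto simp: \<F>_def)
  moreover have "{x \<in> space M. \<forall>q \<in> F. x \<in> E q} \<in> sets M" if "F \<in> \<F>" for F
  proof (rule sets.sets_Collect_countable_All')
    show "{x \<in> space M. x \<in> E q} \<in> sets M" if "q \<in> F" for q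
    proof -
      obtain V a b where "q = (V, a, b)" "V \<in> \<C>"
        using \<open>F \<in> \<F>\<close> \<open>q \<in> F\<close> unfolding \<F>_def by (cases q) blast
      moreover from this have "{x \<in> space M. x \<in> E q} = E (V, a, b)" by (auto simp: E_def)
      ultimately show ?thesis using E by simp
    qed
  qed (use that in \<open>simp add: \<F>_def countable_finite\<close>)
  ultimately have "(\<Union>F \<in> \<F>. {x \<in> space M. \<forall>q \<in> F. x \<in> E q}) \<in> sets M"
    by (intro sets.countable_UN') auto
  moreover have "t -` W \<inter> space M = (\<Union>F \<in> \<F>. {x \<in> space M. \<forall>q \<in> F. x \<in> E q})"
  proof (intro equalityI subsetI)
    fix x assume x: "x \<in> t -` W \<inter> space M"
    have "\<exists>F. finite F \<and> F \<subseteq> \<C> \<times> \<rat> \<times> \<rat> \<and> (\<forall>(V, a, b) \<in> F. t x ` V \<subseteq> {a..b}) \<and>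
      {h \<in> continuous_maps T unit_interval. \<forall>(V, a, b) \<in> F. h ` V \<subseteq> {a..b}} \<subseteq> W"
      by (rule compact_open_network[OF \<C>(3) \<C>(2) W]) (use x in auto)
    then obtain F where F: "F \<in> \<F>" "\<forall>(V, a, b) \<in> F. t x ` V \<subseteq> {a..b}"
      unfolding \<F>_def by (elim exE conjE) simp
    have "\<forall>q \<in> F. x \<in> E q"
      using F(2) x unfolding E_def by fast
    with x F(1) show "x \<in> (\<Union>F \<in> \<F>. {x \<in> space M. \<forall>q \<in> F. x \<in> E q})"
      by blast
  next
    fix x assume "x \<in> (\<Union>F \<in> \<F>. {x \<in> space M. \<forall>q \<in> F. x \<in> E q})"
    then obtain F where F: "F \<in> \<F>" "x \<in> space M" "\<forall>q \<in> F. x \<in> E q" by blast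
    then have "\<forall>(V, a, b) \<in> F. t x ` V \<subseteq> {a..b}"
      unfolding E_def by fast
    moreover have "{h \<in> continuous_maps T unit_interval. \<forall>(V, a, b) \<in> F. h ` V \<subseteq> {a..b}} \<subseteq> W"
      using F(1) by (simp add: \<F>_def)
    ultimately show "x \<in> t -` W \<inter> space M"
      using cont[OF F(2)] F(2) by blast
  qed
  ultimately show ?thesis by simp
qed

section \<open>Measurability and continuity of the semantics\<close>

locale mdp_logic = formula_topology \<Sigma> n \<tau> \<B>
  for \<Sigma> :: "'s set" and n :: "nat \<Rightarrow> nat" and \<tau> :: "nat \<Rightarrow> 'y topology"
    and \<B> :: "nat \<Rightarrow> 'y set set" +
  fixes M :: "'a measure" and c :: real
    and \<gamma>0 :: "'s \<Rightarrow> 'a \<Rightarrow> 'a measure" and \<gamma>1 :: "'s \<Rightarrow> 'a \<Rightarrow> real"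
    and f :: "nat \<Rightarrow> 'y \<Rightarrow> (nat \<Rightarrow> real) \<Rightarrow> real"
  assumes c: "c \<in> {0..1}"
    and mdp: "markov_decision_process M \<Sigma> \<gamma>0 \<gamma>1"
    and continuous_f: "\<And>i. continuous_map
           (prod_topology (product_topology (\<lambda>_. unit_interval) {..<n i}) (\<tau> i))
           unit_interval (\<lambda>(u, y). f i y u)"
begin

abbreviation val :: "('s, 'y) fm \<Rightarrow> 'a \<Rightarrow> real" where
  "val \<equiv> sem c \<gamma>0 \<gamma>1 f"

lemma transition:
  assumes "a \<in> \<Sigma>" and "x \<in> space M"
  shows "prob_space (\<gamma>0 a x)" and "sets (\<gamma>0 a x) = sets M" and "space (\<gamma>0 a x) = space M"
proof -
  have "\<gamma>0 a x \<in> space (prob_algebra M)"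
    using assms mdp unfolding markov_decision_process_def by (meson measurable_space)
  then show "prob_space (\<gamma>0 a x)" "sets (\<gamma>0 a x) = sets M"
    by (auto simp: space_prob_algebra)
  then show "space (\<gamma>0 a x) = space M"
    using sets_eq_imp_space_eq by blast
qed

lemma continuous_f_at:
  assumes "y \<in> topspace (\<tau> i)"
  shows "continuous_map (product_topology (\<lambda>_. unit_interval) {..<n i}) unit_interval (f i y)"
proof -
  have "continuous_map (product_topology (\<lambda>_. unit_interval) {..<n i})
      (prod_topology (product_topology (\<lambda>_. unit_interval) {..<n i}) (\<tau> i)) (\<lambda>u. (u, y))"
    using assms by (intro continuous_map_pairedI) auto
  from continuous_map_compose[OF this continuous_f] show ?thesis
    by (simp add: comp_def)
qed

text \<open>Continuity of \<open>f i y\<close> is known only on the cube of extensional functions,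
  whereas Borel measurability is wanted on a whole space. Composing with the continuous retraction
  \<open>clamp\<close> gives a continuous function of all real sequences, and \<open>clamp\<close>
  changes nothing at the arguments in question.\<close>

lemma f_measurable:
  assumes y: "y \<in> topspace (\<tau> i)"
    and g: "\<And>k. k < n i \<Longrightarrow> g k \<in> borel_measurable M"
    and range: "\<And>k x. k < n i \<Longrightarrow> x \<in> space M \<Longrightarrow> g k x \<in> {0..1}"
  shows "(\<lambda>x. f i y (\<lambda>k\<in>{..<n i}. g k x)) \<in> borel_measurable M"
proof -
  define clamp :: "(nat \<Rightarrow> real) \<Rightarrow> nat \<Rightarrow> real" where "clamp v = (\<lambda>k\<in>{..<n i}. max 0 (min 1 (v k)))" for v
  have "continuous_map euclidean (product_topology (\<lambda>_. unit_interval) {..<n i}) clamp"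
    unfolding continuous_map_componentwise
  proof (intro conjI ballI)
    fix k assume k: "k \<in> {..<n i}"
    have "continuous_on UNIV (\<lambda>v :: nat \<Rightarrow> real. max 0 (min 1 (v k)))"
      by (intro continuous_intros continuous_on_product_coordinates)
    then show "continuous_map euclidean unit_interval (\<lambda>v. clamp v k)"
      using k by (auto simp: clamp_def continuous_map_in_subtopology)
  qed (auto simp: clamp_def)
  from continuous_map_compose[OF this continuous_f_at[OF y]]
  have "continuous_on UNIV (f i y \<circ> clamp)"
    by (simp add: continuous_map_in_subtopology)
  then have "f i y \<circ> clamp \<in> borel_measurable borel"
    by (rule borel_measurable_continuous_onI)
  \<comment> \<open>The value 0 from index \<open>n i\<close> on only completes the tuple to a
    sequence; \<open>clamp\<close> discards these coordinates.\<close>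
  moreover have "(\<lambda>x k. if k < n i then g k x else 0) \<in> borel_measurable M"
  proof (rule measurable_coordinatewise_then_product)
    show "(\<lambda>x. if k < n i then g k x else 0) \<in> borel_measurable M" for k
      using g[of k] by (cases "k < n i") auto
  qed
  ultimately have "(\<lambda>x. (f i y \<circ> clamp) (\<lambda>k. if k < n i then g k x else 0)) \<in> borel_measurable M"
    by (rule measurable_compose[rotated])
  moreover have "(f i y \<circ> clamp) (\<lambda>k. if k < n i then g k x else 0) = f i y (\<lambda>k\<in>{..<n i}. g k x)"
    if "x \<in> space M" for x
    using range[OF _ that] unfolding clamp_def comp_def
    by (intro arg_cong[where f = "f i y"]) (auto simp: restrict_def fun_eq_iff)
  ultimately show ?thesis
    by (simp cong: measurable_cong)
qed

text \<open>Both properties go through one induction because they depend on each other: integrals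
  are bounded using measurability of the integrand, and \<open>f_measurable\<close> needs arguments
  with values in the unit interval. For modalities the value is a convex combination of an integral
  and a reward.\<close>

lemma val_measurable_bounded:
  assumes "\<phi> \<in> formulas"
  shows "val \<phi> \<in> borel_measurable M \<and> (\<forall>x \<in> space M. val \<phi> x \<in> {0..1})"
  using assms
proof induction
  case (4 a \<phi>)
  have \<gamma>: "\<gamma>0 a \<in> M \<rightarrow>\<^sub>M subprob_algebra M" "\<gamma>1 a \<in> borel_measurable M"
    "\<And>x. x \<in> space M \<Longrightarrow> \<gamma>1 a x \<in> {0..1}"
    using mdp 4(1) unfolding markov_decision_process_def by (auto intro: measurable_prob_algebraD)
  have "(\<lambda>x. \<integral>z. val \<phi> z \<partial>(\<gamma>0 a x)) \<in> borel_measurable M"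
    using 4 measurable_compose[OF \<gamma>(1) integral_measurable_subprob_algebra] by blast
  then have "val (Dia a \<phi>) \<in> borel_measurable M"
    using \<gamma>(2) by simp
  moreover have "val (Dia a \<phi>) x \<in> {0..1}" if x: "x \<in> space M" for x
  proof -
    interpret prob_space "\<gamma>0 a x" using transition(1)[OF 4(1) x] .
    have [measurable]: "val \<phi> \<in> borel_measurable (\<gamma>0 a x)"
      using 4 measurable_cong_sets[OF transition(2)[OF 4(1) x] refl] by blast
    have range: "val \<phi> z \<in> {0..1}" if "z \<in> space (\<gamma>0 a x)" for z
      using 4 that transition(3)[OF 4(1) x] by blast
    have "integrable (\<gamma>0 a x) (val \<phi>)"
      using range by (intro integrable_const_bound[where B = 1]) auto
    then have "(\<integral>z. val \<phi> z \<partial>(\<gamma>0 a x)) \<le> 1"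
      using range by (intro integral_le_const) auto
    moreover have "0 \<le> (\<integral>z. val \<phi> z \<partial>(\<gamma>0 a x))"
      using range by (intro integral_nonneg_AE) auto
    ultimately show ?thesis
      using c \<gamma>(3)[OF x] convex_bound_le[of "\<integral>z. val \<phi> z \<partial>(\<gamma>0 a x)" 1 "\<gamma>1 a x" c "1 - c"] by auto
  qed
  ultimately show ?case by blast
next
  case (5 y i \<phi>s)
  have mem: "\<phi>s ! k \<in> set \<phi>s" if "k < n i" for k
    using that 5 by auto
  have val: "val (App i y \<phi>s) = (\<lambda>x. f i y (\<lambda>k\<in>{..<n i}. val (\<phi>s ! k) x))"
    using 5 by (auto simp: fun_eq_iff intro!: arg_cong[where f = "f i y"])
  have "val (App i y \<phi>s) \<in> borel_measurable M"
    unfolding val using 5 mem by (intro f_measurable) auto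
  moreover have "val (App i y \<phi>s) x \<in> {0..1}" if "x \<in> space M" for x
  proof -
    have "(\<lambda>k\<in>{..<n i}. val (\<phi>s ! k) x) \<in> topspace (product_topology (\<lambda>_. unit_interval) {..<n i})"
      using 5 mem that by auto
    then show ?thesis
      using continuous_map_image_subset_topspace[OF continuous_f_at[OF 5(1)]] unfolding val
      by (simp del: topspace_product_topology add: image_subset_iff)
  qed
  ultimately show ?case by blast
qed auto

lemma val_in_unit_interval: "\<phi> \<in> formulas \<Longrightarrow> x \<in> space M \<Longrightarrow> val \<phi> x \<in> {0..1}"
  and val_measurable: "\<phi> \<in> formulas \<Longrightarrow> val \<phi> \<in> borel_measurable M"
  using val_measurable_bounded by blast+

text \<open>The induction keeps the state arbitrary, since continuity of a modality at
  \<open>x\<close> rests on continuity of its argument at every state \<open>z\<close> under the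
  integral. Second countability of the topology on formulas supplies the first countability for
  \<open>integral_continuous_at\<close>.\<close>

lemma val_continuous_at:
  assumes "\<phi> \<in> formulas" and "x \<in> space M" and "\<epsilon> > 0"
  shows "\<exists>p \<in> patterns. \<phi> \<in> instances p \<and> (\<forall>\<psi> \<in> instances p. \<bar>val \<psi> x - val \<phi> x\<bar> < \<epsilon>)"
  using assms
proof (induction arbitrary: x \<epsilon>)
  case 1
  then show ?case by (intro bexI[of _ Top]) auto
next
  case (2 \<phi>)
  then obtain p where p: "p \<in> patterns" "\<phi> \<in> instances p"
    "\<And>\<psi>. \<psi> \<in> instances p \<Longrightarrow> \<bar>val \<psi> x - val \<phi> x\<bar> < \<epsilon>"
    by meson
  then show ?case
    by (intro bexI[of _ "Neg p"]) (fastforce simp: abs_minus_commute)+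
next
  case (3 \<phi>1 \<phi>2)
  obtain p where p: "p \<in> patterns" "\<phi>1 \<in> instances p"
    "\<And>\<psi>. \<psi> \<in> instances p \<Longrightarrow> \<bar>val \<psi> x - val \<phi>1 x\<bar> < \<epsilon>"
    using 3 by meson
  obtain q where q: "q \<in> patterns" "\<phi>2 \<in> instances q"
    "\<And>\<psi>. \<psi> \<in> instances q \<Longrightarrow> \<bar>val \<psi> x - val \<phi>2 x\<bar> < \<epsilon>"
    using 3 by meson
  \<comment> \<open>The minimum does not increase the maximum distance of its arguments, so the same
    \<open>\<epsilon>\<close> serves both components.\<close>
  have "\<bar>min u v - min u' v'\<bar> < \<epsilon>" if "\<bar>u - u'\<bar> < \<epsilon>" "\<bar>v - v'\<bar> < \<epsilon>" for u v u' v' :: real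
    using that by linarith
  then show ?case
    using p q by (intro bexI[of _ "Conj p q"]) auto
next
  case (4 a \<phi>)
  let ?\<mu> = "\<gamma>0 a x"
  have sp: "space ?\<mu> = space M" "sets ?\<mu> = sets M"
    using transition 4 by auto
  have "\<exists>U. openin formula_top U \<and> \<phi> \<in> U \<and> (\<forall>\<psi> \<in> U. \<bar>(\<integral>z. val \<psi> z \<partial>?\<mu>) - (\<integral>z. val \<phi> z \<partial>?\<mu>)\<bar> < \<epsilon>)"
  proof (rule integral_continuous_at[where C = 1])
    show "finite_measure ?\<mu>"
      using transition(1)[OF 4(1,4)] by (simp add: prob_space_def)
    show "first_countable formula_top"
      by (simp add: second_countable_formula_top second_countable_imp_first_countable)
    show "val \<psi> \<in> borel_measurable ?\<mu>" if "\<psi> \<in> topspace formula_top" for \<psi>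
      using val_measurable that measurable_cong_sets[OF sp(2) refl] by auto
    show "\<bar>val \<psi> z\<bar> \<le> 1" if "\<psi> \<in> topspace formula_top" "z \<in> space ?\<mu>" for \<psi> z
      using val_in_unit_interval[of \<psi> z] that sp by auto
    show "\<exists>U. openin formula_top U \<and> \<phi> \<in> U \<and> (\<forall>\<psi> \<in> U. \<bar>val \<psi> z - val \<phi> z\<bar> < e)"
      if "z \<in> space ?\<mu>" "e > 0" for z e
      using 4(3)[of z e] that sp openin_instances by metis
  qed (use 4 in auto)
  then obtain p where p: "p \<in> patterns" "\<phi> \<in> instances p"
    "\<And>\<psi>. \<psi> \<in> instances p \<Longrightarrow> \<bar>(\<integral>z. val \<psi> z \<partial>?\<mu>) - (\<integral>z. val \<phi> z \<partial>?\<mu>)\<bar> < \<epsilon>"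
    unfolding openin_formula_top by blast
  have "\<bar>val (Dia a \<psi>) x - val (Dia a \<phi>) x\<bar> < \<epsilon>" if "\<psi> \<in> instances p" for \<psi>
  proof -
    \<comment> \<open>The reward is independent of the formula and cancels, leaving the difference
      of the integrals with a factor \<open>c\<close> of at most 1.\<close>
    have "\<bar>val (Dia a \<psi>) x - val (Dia a \<phi>) x\<bar> = c * \<bar>(\<integral>z. val \<psi> z \<partial>?\<mu>) - (\<integral>z. val \<phi> z \<partial>?\<mu>)\<bar>"
      using c by (simp add: abs_mult flip: right_diff_distrib)
    also have "\<dots> \<le> \<bar>(\<integral>z. val \<psi> z \<partial>?\<mu>) - (\<integral>z. val \<phi> z \<partial>?\<mu>)\<bar>"
      using c by (simp add: mult_left_le_one_le)
    also have "\<dots> < \<epsilon>" using p(3)[OF that] .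
    finally show ?thesis .
  qed
  then show ?case
    using p 4(1) by (intro bexI[of _ "Dia a p"]) (auto simp del: sem.simps)
next
  case (5 y i \<phi>s)
  have mem: "\<phi>s ! k \<in> set \<phi>s" if "k < n i" for k
    using that 5 by auto
  have val: "val (App i y' \<psi>s) x = f i y' (\<lambda>k\<in>{..<n i}. val (\<psi>s ! k) x)" if "length \<psi>s = n i" for y' \<psi>s
    using that by (auto intro!: arg_cong[where f = "f i y'"])
  let ?X = "product_topology (\<lambda>_. unit_interval) {..<n i}"
  define u where "u = (\<lambda>k\<in>{..<n i}. val (\<phi>s ! k) x)"
  have u: "u \<in> topspace ?X"
    using 5 mem val_in_unit_interval unfolding u_def by auto
  let ?B = "{0..1} \<inter> ball (f i y u) \<epsilon>"
  let ?G = "{z \<in> topspace (prod_topology ?X (\<tau> i)). (case z of (u, y) \<Rightarrow> f i y u) \<in> ?B}"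
  \<comment> \<open>The symbol and its arguments vary simultaneously, so joint continuity is used:
    the open set contains a box \<open>A \<times> V\<close> around \<open>(u, y)\<close>, and
    \<open>A\<close> contains a product of open sets \<open>Q k\<close>. Each \<open>Q k\<close>
    becomes the target for the value of the argument at position \<open>k\<close>.\<close>
  have "openin (prod_topology ?X (\<tau> i)) ?G"
    by (intro openin_continuous_map_preimage[OF continuous_f] openin_open_Int open_ball)
  moreover have "(u, y) \<in> ?G"
    using u 5(1,5) continuous_map_image_subset_topspace[OF continuous_f_at[OF 5(1)]]
    by (simp del: topspace_product_topology add: image_subset_iff)
  ultimately obtain A V where AV: "openin ?X A" "openin (\<tau> i) V" "u \<in> A" "y \<in> V" "A \<times> V \<subseteq> ?G"
    unfolding openin_prod_topology_alt by meson
  obtain Q where Q: "\<And>k. k < n i \<Longrightarrow> openin unit_interval (Q k)" "u \<in> Pi\<^sub>E {..<n i} Q" "Pi\<^sub>E {..<n i} Q \<subseteq> A"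
    using AV(1,3) unfolding openin_product_topology_alt by (metis lessThan_iff)
  have "\<exists>p. (p \<in> patterns \<and> (\<forall>\<psi> \<in> instances p. val \<psi> x \<in> Q k)) \<and> \<phi>s ! k \<in> instances p"
    if k: "k < length \<phi>s" for k
  proof -
    have kn: "k < n i" using k 5 by simp
    obtain Q' where Q': "open Q'" "Q k = {0..1} \<inter> Q'"
      using Q(1)[OF kn] by (auto simp: openin_open)
    have "val (\<phi>s ! k) x \<in> Q'"
      using Q(2) kn Q' by (auto simp: u_def PiE_iff)
    then obtain e where e: "e > 0" "\<And>z. dist z (val (\<phi>s ! k) x) < e \<Longrightarrow> z \<in> Q'"
      using Q'(1) unfolding open_dist by blast
    obtain p where p: "p \<in> patterns" "\<phi>s ! k \<in> instances p"
      "\<And>\<psi>. \<psi> \<in> instances p \<Longrightarrow> \<bar>val \<psi> x - val (\<phi>s ! k) x\<bar> < e"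
      using 5(3) mem[OF kn] 5(4) e(1) by meson
    have "val \<psi> x \<in> Q k" if "\<psi> \<in> instances p" for \<psi>
      using p(3)[OF that] e(2) Q'(2) val_in_unit_interval[of \<psi> x] 5(4)
        instances_subset_formulas[OF p(1)] that by (auto simp: dist_real_def)
    then show ?thesis using p by blast
  qed
  then obtain ps where ps: "list_all2 (\<lambda>\<phi> p. \<phi> \<in> instances p) \<phi>s ps"
    "\<And>k. k < length \<phi>s \<Longrightarrow> ps ! k \<in> patterns \<and> (\<forall>\<psi> \<in> instances (ps ! k). val \<psi> x \<in> Q k)"
    using list_all2_choice[of \<phi>s "\<lambda>k p. p \<in> patterns \<and> (\<forall>\<psi> \<in> instances p. val \<psi> x \<in> Q k)"
        "\<lambda>\<phi> p. \<phi> \<in> instances p"] by blast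
  have len: "length ps = n i"
    using list_all2_lengthD[OF ps(1)] 5(2) by simp
  obtain V' where V': "V' \<in> \<B> i" "y \<in> V'" "V' \<subseteq> V"
    using base AV by blast
  have "App i V' ps \<in> patterns"
    using V' ps(2) len 5(2) by (auto simp: in_set_conv_nth)
  moreover have "App i y \<phi>s \<in> instances (App i V' ps)"
    using V' ps by auto
  moreover have "\<bar>val \<psi> x - val (App i y \<phi>s) x\<bar> < \<epsilon>" if \<psi>: "\<psi> \<in> instances (App i V' ps)" for \<psi>
  proof -
    obtain y' \<psi>s where \<psi>s: "\<psi> = App i y' \<psi>s" "y' \<in> V'" "list_all2 (\<lambda>\<phi> p. \<phi> \<in> instances p) \<psi>s ps"
      using \<psi> by auto
    have len': "length \<psi>s = n i"
      using list_all2_lengthD[OF \<psi>s(3)] len by simp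
    have "(\<lambda>k\<in>{..<n i}. val (\<psi>s ! k) x) \<in> Pi\<^sub>E {..<n i} Q"
      using \<psi>s(3) ps(2) len' 5(2) by (auto simp: list_all2_conv_all_nth)
    then have "((\<lambda>k\<in>{..<n i}. val (\<psi>s ! k) x), y') \<in> ?G"
      using Q(3) AV(5) V'(3) \<psi>s(2) by blast
    then have "f i y' (\<lambda>k\<in>{..<n i}. val (\<psi>s ! k) x) \<in> ball (f i y u) \<epsilon>"
      by auto
    then show ?thesis
      unfolding \<psi>s(1) val[OF len'] val[OF 5(2)] u_def[symmetric]
      by (simp add: dist_real_def abs_minus_commute)
  qed
  ultimately show ?case by blast
qed

lemma theory_map_continuous:
  assumes x: "x \<in> space M"
  shows "theory_map formulas c \<gamma>0 \<gamma>1 f x \<in> continuous_maps formula_top unit_interval"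
proof -
  have "continuous_map formula_top unit_interval (\<lambda>\<phi>. val \<phi> x)"
    unfolding continuous_map
  proof (intro conjI allI impI)
    show "(\<lambda>\<phi>. val \<phi> x) ` topspace formula_top \<subseteq> topspace unit_interval"
      using val_in_unit_interval x by auto
    fix U :: "real set"
    assume "openin unit_interval U"
    then obtain U' where U': "open U'" "U = {0..1} \<inter> U'"
      by (auto simp: openin_open)
    show "openin formula_top {\<phi> \<in> topspace formula_top. val \<phi> x \<in> U}"
      unfolding openin_formula_top
    proof (intro conjI ballI)
      fix \<phi> assume "\<phi> \<in> {\<phi> \<in> topspace formula_top. val \<phi> x \<in> U}"
      then have \<phi>: "\<phi> \<in> formulas" "val \<phi> x \<in> U'"
        using U' by auto
      then obtain e where e: "e > 0" "\<And>z. dist z (val \<phi> x) < e \<Longrightarrow> z \<in> U'"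
        using U'(1) unfolding open_dist by blast
      obtain p where p: "p \<in> patterns" "\<phi> \<in> instances p"
        "\<And>\<psi>. \<psi> \<in> instances p \<Longrightarrow> \<bar>val \<psi> x - val \<phi> x\<bar> < e"
        using val_continuous_at[OF \<phi>(1) x e(1)] by blast
      have "val \<psi> x \<in> U \<and> \<psi> \<in> formulas" if "\<psi> \<in> instances p" for \<psi>
        using p(3)[OF that] e(2) U'(2) val_in_unit_interval[of \<psi> x] x
          instances_subset_formulas[OF p(1)] that by (auto simp: dist_real_def)
      with p show "\<exists>p \<in> patterns. \<phi> \<in> instances p \<and>
          instances p \<subseteq> {\<phi> \<in> topspace formula_top. val \<phi> x \<in> U}"
        by auto
    qed auto
  qed
  then have "continuous_map formula_top unit_interval (theory_map formulas c \<gamma>0 \<gamma>1 f x)"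
    by (rule continuous_map_eq) (simp add: theory_map_def)
  then show ?thesis
    by (simp add: continuous_maps_def theory_map_def)
qed

lemma theory_map_topologisable:
  "topologisable_by M formulas (theory_map formulas c \<gamma>0 \<gamma>1 f) formula_top"
  unfolding topologisable_by_def
proof (intro conjI ballI allI impI)
  show "continuous_map formula_top unit_interval (theory_map formulas c \<gamma>0 \<gamma>1 f x)"
    if "x \<in> space M" for x
    using theory_map_continuous[OF that] by (simp add: continuous_maps_def)
  fix W
  assume W: "openin (compact_open_topology formula_top unit_interval) W"
  have "theory_map formulas c \<gamma>0 \<gamma>1 f -` W \<inter> space M \<in> sets M"
  proof (rule compact_open_preimage_measurable[OF second_countable_formula_top theory_map_continuous _ W])
    show "(\<lambda>x. theory_map formulas c \<gamma>0 \<gamma>1 f x \<phi>) \<in> borel_measurable M"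
      if "\<phi> \<in> topspace formula_top" for \<phi>
      using that val_measurable by (simp add: theory_map_def)
  qed
  \<comment> \<open>The preimage lies in \<open>sets M\<close> itself, hence in every
    completion.\<close>
  then show "universally_measurable M (theory_map formulas c \<gamma>0 \<gamma>1 f -` W \<inter> space M)"
    unfolding universally_measurable_def by (metis sets_completionI_sets)
qed simp

end

section \<open>Choice of a countable base for each parameter space and the resulting
  topology\<close>

theorem theorem5p13:
  fixes M :: "'a measure"
    and \<Sigma> :: "'s set"
    and c :: real
    and \<gamma>0 :: "'s \<Rightarrow> 'a \<Rightarrow> 'a measure"
    and \<gamma>1 :: "'s \<Rightarrow> 'a \<Rightarrow> real"
    and Y :: "nat \<Rightarrow> 'y set"
    and n :: "nat \<Rightarrow> nat"
    and f :: "nat \<Rightarrow> 'y \<Rightarrow> (nat \<Rightarrow> real) \<Rightarrow> real"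
    and \<tau> :: "nat \<Rightarrow> 'y topology"
  assumes "analytic_space TYPE('b) M"
    and "countable \<Sigma>"
    and "c \<in> {0..1}"
    and "markov_decision_process M \<Sigma> \<gamma>0 \<gamma>1"
    and "\<And>i. topspace (\<tau> i) = Y i"
    and "\<And>i. second_countable (\<tau> i)"
    and "\<And>i. Hausdorff_space (\<tau> i)"
    and "\<And>i. continuous_map
           (prod_topology (product_topology (\<lambda>_. unit_interval) {..<n i}) (\<tau> i))
           unit_interval (\<lambda>(u, y). f i y u)"
  shows "\<exists>T. second_countable T \<and> Hausdorff_space T \<and>
           topologisable_by M (language \<Sigma> Y n)
             (theory_map (language \<Sigma> Y n) c \<gamma>0 \<gamma>1 f) T"
proof -
  have Y: "Y = (\<lambda>i. topspace (\<tau> i))"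
    using assms(5) by auto
  have "\<forall>i. \<exists>\<B>. countable \<B> \<and> (\<forall>V \<in> \<B>. openin (\<tau> i) V) \<and>
      (\<forall>U y. openin (\<tau> i) U \<and> y \<in> U \<longrightarrow> (\<exists>V \<in> \<B>. y \<in> V \<and> V \<subseteq> U))"
    using assms(6) unfolding second_countable_def by blast
  then obtain \<B> where \<B>: "\<And>i. countable (\<B> i)" "\<And>i V. V \<in> \<B> i \<Longrightarrow> openin (\<tau> i) V"
    "\<And>i U y. openin (\<tau> i) U \<Longrightarrow> y \<in> U \<Longrightarrow> \<exists>V \<in> \<B> i. y \<in> V \<and> V \<subseteq> U"
    by metis
  interpret mdp_logic \<Sigma> n \<tau> \<B> M c \<gamma>0 \<gamma>1 f
    by unfold_locales (use assms \<B> in auto)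
  show ?thesis
    unfolding Y
    using second_countable_formula_top Hausdorff_formula_top theory_map_topologisable by blast
qed

end
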